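(* Let $W$ be a Weyl tensor of Petrov type III, with canonical expression $\mathcal W=\mathcal U\,\tilde\otimes\,\mathcal L$, where $\{\mathcal U,\mathcal L,\mathcal K\}$ is a null frame of self-dual bivectors. Define $$\Pi=\mathcal U\cdot\overline{\mathcal U},\ \Lambda=\mathcal L\cdot\overline{\mathcal L},\ \mathrm K=\mathcal K\cdot\overline{\mathcal K},\ \mathrm N=\mathcal U\cdot\overline{\mathcal L},\ \Omega=\mathcal U\cdot\overline{\mathcal K},\ \mathrm M=\mathcal L\cdot\overline{\mathcal K}.$$ Then the Bel-Robinson tensor $T$ of $W$ admits the canonical expression $$T=\Lambda\,\tilde\otimes\,\Pi+\mathrm N\,\tilde\otimes\,\overline{\mathrm N}.$$ Associated with the sole (vanishing) eigenvalue we have a two-dimensional space of eigentensors $E=\langle\mathrm M,\overline{\mathrm M}\rangle$ and three invariant subspaces: $I_1=\langle\Pi,\Lambda,\mathrm K\rangle$, containing (up to scalar factor) the sole eigentensor $\Lambda$; $I_2=\langle\Omega,\overline{\mathrm N}\rangle$, containing the sole eigentensor $\overline{\mathrm N}$; and $I_3=\langle\overline\Omega,\mathrm N\rangle$, containing the sole eigentensor $\mathrm N$.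
   Context: $(V,g)$ is an oriented 4-dimensional real vector space with a Lorentzian metric of signature $(-,+,+,+)$ (the tangent space of a space-time at a point); indices are moved with $g$; $\eta$ is the metric volume element; $( *F)_{\alpha\beta}=\frac12\eta_{\alpha\beta\mu\nu}F^{\mu\nu}$, $( *W)_{\alpha\beta\mu\nu}=\frac12\eta_{\alpha\beta}{}^{\rho\sigma}W_{\rho\sigma\mu\nu}$. A self-dual (SD) bivector is a complex 2-form $\mathcal F$ with $*\mathcal F=\mathrm i\mathcal F$; these form a complex 3-dimensional space with metric $\mathcal G(\mathcal F,\mathcal H)=\frac12\mathcal F_{\alpha\beta}\mathcal H^{\alpha\beta}$. A null frame $\{\mathcal U,\mathcal L,\mathcal K\}$ of SD bivectors satisfies $\mathcal G(\mathcal U,\mathcal U)=-1$, $\mathcal G(\mathcal L,\mathcal K)=-1$, all other products being zero. $A\,\tilde\otimes\,B=A\otimes B+B\otimes A$. A Weyl tensor $W$ is a real 4-tensor with the algebraic symmetries of a Riemann tensor and vanishing traces; $\mathcal W=\frac12(W-\mathrm i*W)$ acts on SD bivectors by $\mathcal W(\mathcal F)_{\alpha\beta}=\frac12\mathcal W_{\alpha\beta}{}^{\mu\nu}\mathcal F_{\mu\nu}$. Type III means that this map is nilpotent with minimal polynomial of degree 3; it is known that then the canonical expression of the claim exists. The Bel-Robinson (BR) tensor of $W$ is $T_{\alpha\mu\beta\nu}=\mathcal W_{\alpha}{}^{\rho}{}_{\beta}{}^{\sigma}\,\overline{\mathcal W}_{\mu\rho\nu\sigma}$; it is totally symmetric and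 traceless and acts on the (complexified) 9-dimensional space of traceless symmetric 2-tensors by $T(A)_{\alpha\beta}=T_{\alpha\beta}{}^{\mu\nu}A_{\mu\nu}$; an eigentensor is an eigenvector of this map. For 2-tensors $(A\cdot B)_{\alpha\beta}=A_{\alpha}{}^{\mu}B_{\mu\beta}$. $\langle\cdot\rangle$ denotes (complex) linear span. *)

theory Defs
  imports "HOL-Analysis.Analysis" "HOL-Computational_Algebra.Polynomial"
begin

text \<open>
  Tensors on a 4-dimensional real vector space \<open>V\<close> are given by their covariant components in an
  arbitrary basis, indexed by the type \<open>4\<close>; \<open>g\<close> is the Gram matrix of the metric in this basis.
  Complex 2-tensors live in \<open>complex ^ (4 \<times> 4)\<close>, so that the complex linear algebra of
  \<^locale>\<open>vector_space\<close> (\<open>vec.span\<close>, \<open>vec.dim\<close>, \<open>vec.subspace\<close>, for the scalar product \<open>*s\<close>)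
  applies to them.
\<close>

type_synonym tensor2 = "complex ^ (4 \<times> 4)"
type_synonym 'a tensor4 = "4 \<Rightarrow> 4 \<Rightarrow> 4 \<Rightarrow> 4 \<Rightarrow> 'a"

definition minkowski :: "real ^ 4 ^ 4" where
  "minkowski = (\<chi> i j. if i \<noteq> j then 0 else if i = 1 then - 1 else 1)"

text \<open>The columns of \<open>P\<close> below form an orthonormal basis.\<close>

definition lorentzian :: "real ^ 4 ^ 4 \<Rightarrow> bool" where
  "lorentzian g \<longleftrightarrow> transpose g = g \<and>
     (\<exists>P. invertible P \<and> transpose P ** g ** P = minkowski)"

definition ginv :: "real ^ 4 ^ 4 \<Rightarrow> 4 \<Rightarrow> 4 \<Rightarrow> real" where
  "ginv g a b = matrix_inv g $ a $ b"

definition levi_civita :: "real tensor4" where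
  "levi_civita a b c d = det (\<chi> i::4.
     axis (if i = 1 then a else if i = 2 then b else if i = 3 then c else d) 1)"

text \<open>
  The orientation is encoded by the sign \<open>s\<close>: \<open>s = 1\<close> if the reference basis is positively oriented,
  and \<open>s = - 1\<close> otherwise.
\<close>

definition vol :: "real ^ 4 ^ 4 \<Rightarrow> real \<Rightarrow> real tensor4" where
  "vol g s a b c d = s * sqrt \<bar>det g\<bar> * levi_civita a b c d"

definition cnj2 :: "tensor2 \<Rightarrow> tensor2" where
  "cnj2 A = (\<chi> p. cnj (A $ p))"

definition raise2 :: "real ^ 4 ^ 4 \<Rightarrow> tensor2 \<Rightarrow> tensor2" where
  "raise2 g A = vec_lambda (\<lambda>(a, b).
     \<Sum>m\<in>UNIV. \<Sum>n\<in>UNIV. of_real (ginv g a m) * of_real (ginv g b n) * A $ (m, n))"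

definition dot2 :: "real ^ 4 ^ 4 \<Rightarrow> tensor2 \<Rightarrow> tensor2 \<Rightarrow> tensor2" where
  "dot2 g A B = vec_lambda (\<lambda>(a, b).
     \<Sum>m\<in>UNIV. \<Sum>n\<in>UNIV. A $ (a, m) * of_real (ginv g m n) * B $ (n, b))"

definition sym_tensor :: "tensor2 \<Rightarrow> tensor2 \<Rightarrow> complex tensor4" where
  "sym_tensor A B a b c d = A $ (a, b) * B $ (c, d) + B $ (a, b) * A $ (c, d)"

definition traceless_sym :: "real ^ 4 ^ 4 \<Rightarrow> tensor2 set" where
  "traceless_sym g = {A. (\<forall>a b. A $ (a, b) = A $ (b, a)) \<and>
     (\<Sum>a\<in>UNIV. \<Sum>b\<in>UNIV. of_real (ginv g a b) * A $ (a, b)) = 0}"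

definition hodge2 :: "real ^ 4 ^ 4 \<Rightarrow> real \<Rightarrow> tensor2 \<Rightarrow> tensor2" where
  "hodge2 g s F = vec_lambda (\<lambda>(a, b).
     1 / 2 * (\<Sum>m\<in>UNIV. \<Sum>n\<in>UNIV. of_real (vol g s a b m n) * raise2 g F $ (m, n)))"

definition sd_bivectors :: "real ^ 4 ^ 4 \<Rightarrow> real \<Rightarrow> tensor2 set" where
  "sd_bivectors g s =
     {F. (\<forall>a b. F $ (a, b) = - F $ (b, a)) \<and> hodge2 g s F = \<i> *s F}"

definition bimetric :: "real ^ 4 ^ 4 \<Rightarrow> tensor2 \<Rightarrow> tensor2 \<Rightarrow> complex" where
  "bimetric g F H = 1 / 2 * (\<Sum>a\<in>UNIV. \<Sum>b\<in>UNIV. F $ (a, b) * raise2 g H $ (a, b))"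

definition null_frame :: "real ^ 4 ^ 4 \<Rightarrow> real \<Rightarrow> tensor2 \<Rightarrow> tensor2 \<Rightarrow> tensor2 \<Rightarrow> bool" where
  "null_frame g s U L K \<longleftrightarrow>
     U \<in> sd_bivectors g s \<and> L \<in> sd_bivectors g s \<and> K \<in> sd_bivectors g s \<and>
     bimetric g U U = - 1 \<and> bimetric g L K = - 1 \<and>
     bimetric g U L = 0 \<and> bimetric g U K = 0 \<and> bimetric g L L = 0 \<and> bimetric g K K = 0"

definition weyl_tensor :: "real ^ 4 ^ 4 \<Rightarrow> real tensor4 \<Rightarrow> bool" where
  "weyl_tensor g W \<longleftrightarrow>
     (\<forall>a b c d. W a b c d = - W b a c d \<and> W a b c d = - W a b d c \<and> W a b c d = W c d a b) \<and>
     (\<forall>a b c d. W a b c d + W a c d b + W a d b c = 0) \<and>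
     (\<forall>b d. (\<Sum>a\<in>UNIV. \<Sum>c\<in>UNIV. ginv g a c * W a b c d) = 0)"

definition hodge4 :: "real ^ 4 ^ 4 \<Rightarrow> real \<Rightarrow> real tensor4 \<Rightarrow> real tensor4" where
  "hodge4 g s W a b m n =
     1 / 2 * (\<Sum>r\<in>UNIV. \<Sum>t\<in>UNIV. \<Sum>r'\<in>UNIV. \<Sum>t'\<in>UNIV.
       vol g s a b r' t' * ginv g r' r * ginv g t' t * W r t m n)"

definition sd_weyl :: "real ^ 4 ^ 4 \<Rightarrow> real \<Rightarrow> real tensor4 \<Rightarrow> complex tensor4" where
  "sd_weyl g s W a b m n = 1 / 2 * (of_real (W a b m n) - \<i> * of_real (hodge4 g s W a b m n))"

definition sd_weyl_map :: "real ^ 4 ^ 4 \<Rightarrow> real \<Rightarrow> real tensor4 \<Rightarrow> tensor2 \<Rightarrow> tensor2" where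
  "sd_weyl_map g s W F = vec_lambda (\<lambda>(a, b).
     1 / 2 * (\<Sum>m\<in>UNIV. \<Sum>n\<in>UNIV. sd_weyl g s W a b m n * raise2 g F $ (m, n)))"

definition poly_op :: "complex poly \<Rightarrow> (tensor2 \<Rightarrow> tensor2) \<Rightarrow> tensor2 \<Rightarrow> tensor2" where
  "poly_op p f F = (\<Sum>i\<le>degree p. coeff p i *s (f ^^ i) F)"

definition min_poly_on :: "tensor2 set \<Rightarrow> (tensor2 \<Rightarrow> tensor2) \<Rightarrow> complex poly \<Rightarrow> bool" where
  "min_poly_on S f p \<longleftrightarrow> lead_coeff p = 1 \<and> (\<forall>F\<in>S. poly_op p f F = 0) \<and>
     (\<forall>q. q \<noteq> 0 \<and> (\<forall>F\<in>S. poly_op q f F = 0) \<longrightarrow> degree p \<le> degree q)"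

definition nilpotent_on :: "tensor2 set \<Rightarrow> (tensor2 \<Rightarrow> tensor2) \<Rightarrow> bool" where
  "nilpotent_on S f \<longleftrightarrow> (\<exists>k. \<forall>F\<in>S. (f ^^ k) F = 0)"

definition petrov_type_III :: "real ^ 4 ^ 4 \<Rightarrow> real \<Rightarrow> real tensor4 \<Rightarrow> bool" where
  "petrov_type_III g s W \<longleftrightarrow>
     nilpotent_on (sd_bivectors g s) (sd_weyl_map g s W) \<and>
     (\<exists>p. min_poly_on (sd_bivectors g s) (sd_weyl_map g s W) p \<and> degree p = 3)"

definition bel_robinson :: "real ^ 4 ^ 4 \<Rightarrow> real \<Rightarrow> real tensor4 \<Rightarrow> complex tensor4" where
  "bel_robinson g s W a m b n =
     (\<Sum>r\<in>UNIV. \<Sum>t\<in>UNIV. \<Sum>r'\<in>UNIV. \<Sum>t'\<in>UNIV.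
       of_real (ginv g r r') * of_real (ginv g t t') *
       sd_weyl g s W a r' b t' * cnj (sd_weyl g s W m r n t))"

definition tensor_map :: "real ^ 4 ^ 4 \<Rightarrow> complex tensor4 \<Rightarrow> tensor2 \<Rightarrow> tensor2" where
  "tensor_map g T A = vec_lambda (\<lambda>(a, b).
     \<Sum>m\<in>UNIV. \<Sum>n\<in>UNIV. T a b m n * raise2 g A $ (m, n))"

definition eigentensor :: "real ^ 4 ^ 4 \<Rightarrow> complex tensor4 \<Rightarrow> complex \<Rightarrow> tensor2 \<Rightarrow> bool" where
  "eigentensor g T c A \<longleftrightarrow> A \<in> traceless_sym g \<and> A \<noteq> 0 \<and> tensor_map g T A = c *s A"

definition invariant_subspace :: "real ^ 4 ^ 4 \<Rightarrow> complex tensor4 \<Rightarrow> tensor2 set \<Rightarrow> bool" where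
  "invariant_subspace g T S \<longleftrightarrow>
     vec.subspace S \<and> S \<subseteq> traceless_sym g \<and> tensor_map g T ` S \<subseteq> S"

text \<open>\<open>X\<close> is, up to scalar factors, the only eigentensor lying in \<open>S\<close>, for whatever eigenvalue.\<close>

definition sole_eigentensor ::
    "real ^ 4 ^ 4 \<Rightarrow> complex tensor4 \<Rightarrow> tensor2 set \<Rightarrow> tensor2 \<Rightarrow> bool" where
  "sole_eigentensor g T S X \<longleftrightarrow>
     X \<in> S \<and> (\<exists>c. eigentensor g T c X) \<and>
     (\<forall>c A. A \<in> S \<and> eigentensor g T c A \<longrightarrow> (\<exists>k. A = k *s X))"

end

theory Submission
  imports Defs
begin

text \<open>
  For antisymmetric complex \<open>4 \<times> 4\<close> matrices \<open>X\<close>, \<open>Y\<close> the Levi-Civita dual satisfies the polynomial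
  identity \<open>dual X ** Y + dual Y ** X = c I\<close>. Applied to the contravariant components of eigenvectors
  of the Hodge operator it says that, as endomorphisms, two self-dual bivectors anticommute up to
  a multiple of the identity, whereas a self-dual and an anti-self-dual bivector commute and are
  orthogonal; no adapted basis is needed. Hence the products \<open>F \<cdot> cnj H\<close> are symmetric and
  traceless, and the contraction of \<open>F \<cdot> cnj H\<close> with \<open>F' \<cdot> cnj H'\<close> is \<open>G(F, F') cnj G(H, H')\<close>.
  So the nine products of the null frame are, up to order, their own dual basis, and contracting
  the canonical expression of \<open>T\<close> with them gives \<open>K \<mapsto> \<Pi> \<mapsto> \<Lambda> \<mapsto> 0\<close>,
  \<open>\<Omega> \<mapsto> cnj N \<mapsto> 0\<close>, \<open>cnj \<Omega> \<mapsto> N \<mapsto> 0\<close>, \<open>M, cnj M \<mapsto> 0\<close>, and \<open>T ^ 3 = 0\<close>.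
\<close>

section \<open>The Levi-Civita symbol\<close>

lemma det_axis_swap:
  fixes r :: "4 \<Rightarrow> 4"
  assumes "i \<noteq> j"
  shows "det (\<chi> k. axis (r (Transposition.transpose i j k)) 1 :: real ^ 4 ^ 4) = - det (\<chi> k. axis (r k) 1 :: real ^ 4 ^ 4)"
  using det_permute_rows[OF permutes_swap_id[of i UNIV j], of "\<chi> k. axis (r k) (1::real)"] assms
  by (simp add: sign_swap_id)

text \<open>The indices label the rows of a determinant, so exchanging two neighbours exchanges two
  rows. Adjacent transpositions generate all permutations.\<close>

lemma levi_civita_swap:
  shows "levi_civita b a c d = - levi_civita a b c d"
    and "levi_civita a c b d = - levi_civita a b c d"
    and "levi_civita a b d c = - levi_civita a b c d"
proof -
  let ?r = "\<lambda>i::4. if i = 1 then a else if i = 2 then b else if i = 3 then c else d"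
  have eq: "P = Q" if "\<And>k. P $ k = Q $ k" for P Q :: "real ^ 4 ^ 4"
    using that by (simp add: vec_eq_iff)
  have "levi_civita b a c d = det (\<chi> k. axis (?r (Transposition.transpose 1 2 k)) 1 :: real ^ 4 ^ 4)"
    unfolding levi_civita_def by (intro arg_cong[where f = det] eq) (simp add: transpose_def)
  then show "levi_civita b a c d = - levi_civita a b c d"
    using det_axis_swap[of 1 2 ?r] by (simp add: levi_civita_def)
  have "levi_civita a c b d = det (\<chi> k. axis (?r (Transposition.transpose 2 3 k)) 1 :: real ^ 4 ^ 4)"
    unfolding levi_civita_def by (intro arg_cong[where f = det] eq) (simp add: transpose_def)
  then show "levi_civita a c b d = - levi_civita a b c d"
    using det_axis_swap[of 2 3 ?r] by (simp add: levi_civita_def)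
  have "levi_civita a b d c = det (\<chi> k. axis (?r (Transposition.transpose 3 4 k)) 1 :: real ^ 4 ^ 4)"
    unfolding levi_civita_def
  \<comment> \<open>Index 4 is the fall-through branch of the nested conditional, so this swap is
    checked index by index.\<close>
  proof (intro arg_cong[where f = det] eq)
    show "(\<chi> i. axis (if i = 1 then a else if i = 2 then b else if i = 3 then d else c) 1) $ k =
      (\<chi> k. axis (?r (Transposition.transpose 3 4 k)) 1 :: real ^ 4 ^ 4) $ k" for k
      using exhaust_4[of k] by (elim disjE) (simp_all add: transpose_def)
  qed
  then show "levi_civita a b d c = - levi_civita a b c d"
    using det_axis_swap[of 3 4 ?r] by (simp add: levi_civita_def)
qed

lemma levi_civita_repeat [simp]:
  "levi_civita a a c d = 0" "levi_civita c a a d = 0" "levi_civita c d a a = 0"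
  "levi_civita a c a d = 0" "levi_civita c a d a = 0" "levi_civita a c d a = 0"
proof -
  show *: "levi_civita a a c d = 0" "levi_civita c a a d = 0" "levi_civita c d a a = 0" for a c d
    using levi_civita_swap[of a a c d] levi_civita_swap[of c a a d] levi_civita_swap[of c d a a]
    by auto
  show **: "levi_civita a c a d = 0" "levi_civita c a d a = 0" for a c d
    using levi_civita_swap(2)[of a c a d] levi_civita_swap(2)[of c d a a] * by auto
  show "levi_civita a c d a = 0"
    using levi_civita_swap(3)[of a c d a] ** by auto
qed

lemma levi_civita_1234: "levi_civita 1 2 3 4 = 1"
proof -
  have "(\<chi> i::4. axis (if i = 1 then 1 else if i = 2 then 2 else if i = 3 then 3 else 4) (1::real)) = mat 1"
    unfolding vec_eq_iff forall_4 by (simp add: mat_def axis_def)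
  then show ?thesis
    by (simp add: levi_civita_def)
qed

text \<open>The 23 swap equations used here form a spanning tree on the 24 permutations, rooted at
  the identity, so each value follows by counting signs along a path.\<close>

lemma levi_civita_permutation:
  "levi_civita 1 2 3 4 = 1" "levi_civita 1 2 4 3 = - 1" "levi_civita 1 3 2 4 = - 1"
  "levi_civita 1 3 4 2 = 1" "levi_civita 1 4 2 3 = 1" "levi_civita 1 4 3 2 = - 1"
  "levi_civita 2 1 3 4 = - 1" "levi_civita 2 1 4 3 = 1" "levi_civita 2 3 1 4 = 1"
  "levi_civita 2 3 4 1 = - 1" "levi_civita 2 4 1 3 = - 1" "levi_civita 2 4 3 1 = 1"
  "levi_civita 3 1 2 4 = 1" "levi_civita 3 1 4 2 = - 1" "levi_civita 3 2 1 4 = - 1"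
  "levi_civita 3 2 4 1 = 1" "levi_civita 3 4 1 2 = 1" "levi_civita 3 4 2 1 = - 1"
  "levi_civita 4 1 2 3 = - 1" "levi_civita 4 1 3 2 = 1" "levi_civita 4 2 1 3 = 1"
  "levi_civita 4 2 3 1 = - 1" "levi_civita 4 3 1 2 = - 1" "levi_civita 4 3 2 1 = 1"
  using levi_civita_1234
    levi_civita_swap(1)[of 2 1 3 4] levi_civita_swap(2)[of 1 3 2 4] levi_civita_swap(3)[of 1 2 4 3]
    levi_civita_swap(2)[of 2 3 1 4] levi_civita_swap(3)[of 2 1 4 3] levi_civita_swap(1)[of 3 1 2 4]
    levi_civita_swap(3)[of 1 3 4 2] levi_civita_swap(2)[of 1 4 2 3] levi_civita_swap(1)[of 3 2 1 4]
    levi_civita_swap(3)[of 2 3 4 1] levi_civita_swap(2)[of 2 4 1 3] levi_civita_swap(3)[of 3 1 4 2]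
    levi_civita_swap(2)[of 1 4 3 2] levi_civita_swap(1)[of 4 1 2 3] levi_civita_swap(3)[of 3 2 4 1]
    levi_civita_swap(2)[of 2 4 3 1] levi_civita_swap(1)[of 4 2 1 3] levi_civita_swap(2)[of 3 4 1 2]
    levi_civita_swap(1)[of 4 1 3 2] levi_civita_swap(2)[of 3 4 2 1] levi_civita_swap(1)[of 4 2 3 1]
    levi_civita_swap(1)[of 4 3 1 2] levi_civita_swap(1)[of 4 3 2 1]
  by linarith+

text \<open>The metric-free part of the Hodge operator: it takes contravariant components to
  covariant ones, with the symbol in place of the volume element.\<close>

definition dual :: "complex ^ 4 ^ 4 \<Rightarrow> complex ^ 4 ^ 4" where
  "dual X = (\<chi> a b. 1 / 2 * (\<Sum>m\<in>UNIV. \<Sum>n\<in>UNIV. of_real (levi_civita a b m n) * X $ m $ n))"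

lemma dual_component:
  "dual X $ a $ a = 0"
  "dual X $ 1 $ 2 = (X $ 3 $ 4 - X $ 4 $ 3) / 2" "dual X $ 2 $ 1 = (X $ 4 $ 3 - X $ 3 $ 4) / 2"
  "dual X $ 1 $ 3 = (X $ 4 $ 2 - X $ 2 $ 4) / 2" "dual X $ 3 $ 1 = (X $ 2 $ 4 - X $ 4 $ 2) / 2"
  "dual X $ 1 $ 4 = (X $ 2 $ 3 - X $ 3 $ 2) / 2" "dual X $ 4 $ 1 = (X $ 3 $ 2 - X $ 2 $ 3) / 2"
  "dual X $ 2 $ 3 = (X $ 1 $ 4 - X $ 4 $ 1) / 2" "dual X $ 3 $ 2 = (X $ 4 $ 1 - X $ 1 $ 4) / 2"
  "dual X $ 2 $ 4 = (X $ 3 $ 1 - X $ 1 $ 3) / 2" "dual X $ 4 $ 2 = (X $ 1 $ 3 - X $ 3 $ 1) / 2"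
  "dual X $ 3 $ 4 = (X $ 1 $ 2 - X $ 2 $ 1) / 2" "dual X $ 4 $ 3 = (X $ 2 $ 1 - X $ 1 $ 2) / 2"
  by (simp_all only: dual_def sum_4 vec_lambda_beta levi_civita_permutation levi_civita_repeat
      of_real_0 of_real_1 of_real_minus) simp_all

text \<open>Polarization of \<open>dual X ** X = mat (- Pf X)\<close>.\<close>

lemma dual_anticommute:
  assumes X: "transpose X = - X" and Y: "transpose Y = - Y"
  shows "dual X ** Y + dual Y ** X = mat (trace (dual X ** Y) / 2)"
proof -
  have *: "Z $ a $ b = - Z $ b $ a" if "transpose Z = - Z" for a b and Z :: "complex ^ 4 ^ 4"
    using arg_cong[OF that, of "\<lambda>M. M $ b $ a"] by (simp add: transpose_def)
  have 0: "X $ a $ a = 0" "Y $ a $ a = 0" for a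
    using *[OF X, of a a] *[OF Y, of a a] unfolding complex_eq_iff by simp_all
  note entries = 0 *[OF X, of 2 1] *[OF X, of 3 1] *[OF X, of 4 1] *[OF X, of 3 2] *[OF X, of 4 2]
    *[OF X, of 4 3] *[OF Y, of 2 1] *[OF Y, of 3 1] *[OF Y, of 4 1] *[OF Y, of 3 2] *[OF Y, of 4 2]
    *[OF Y, of 4 3]
  have 1: "(mat c :: complex ^ 4 ^ 4) $ a $ a = c" for c a
    by (simp add: mat_def)
  have 2: "(mat c :: complex ^ 4 ^ 4) $ a $ b = 0" if "a \<noteq> b" for c a b
    using that by (simp add: mat_def)
  have 3: "(A ** B) $ a $ b = A $ a $ 1 * B $ 1 $ b + A $ a $ 2 * B $ 2 $ b + A $ a $ 3 * B $ 3 $ b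
      + A $ a $ 4 * B $ 4 $ b" for A B :: "complex ^ 4 ^ 4" and a b
    by (simp add: matrix_matrix_mult_def sum_4)
  have 4: "trace A = A $ 1 $ 1 + A $ 2 $ 2 + A $ 3 $ 3 + A $ 4 $ 4" for A :: "complex ^ 4 ^ 4"
    by (simp add: trace_def sum_4)
  show ?thesis
    unfolding vec_eq_iff forall_4
    by (simp add: 1 2 3 4 dual_component entries field_simps)
qed

section \<open>Scalar multiples of complex matrices, written \<open>mat c ** A\<close>\<close>

lemma mat_mult_component: "(mat c ** A) $ i $ j = c * (A $ i $ j :: complex)"
  by (simp add: matrix_matrix_mult_def mat_def if_distrib[where f = "\<lambda>x. x * _"] cong: if_cong)

lemma mat_mult_mat: "mat c ** mat d = (mat (c * d) :: complex ^ 'n ^ 'n)"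
  by (simp add: vec_eq_iff mat_mult_component) (simp add: mat_def)

lemma trace_mat_mult: "trace (mat c ** A) = c * trace (A :: complex ^ 'n ^ 'n)"
  by (simp add: trace_def mat_mult_component sum_distrib_left)

lemma mat_mult_cancel:
  assumes "mat c ** A = mat c ** (B :: complex ^ 'n ^ 'n)" "c \<noteq> 0"
  shows "A = B"
  using assms by (simp add: vec_eq_iff mat_mult_component)

lemma matrix_add_rdistrib: "(A + B) ** C = A ** C + B ** (C :: complex ^ 'n ^ 'n)"
  by (simp add: vec_eq_iff matrix_matrix_mult_def sum.distrib distrib_right)

lemma matrix_mult_minus:
  fixes A B :: "complex ^ 'n ^ 'n"
  shows "A ** (- B) = - (A ** B)" and "(- A) ** B = - (A ** B)"
  by (simp_all add: vec_eq_iff matrix_matrix_mult_def sum_negf)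

section \<open>2-tensors as matrices and as endomorphisms\<close>

definition lower :: "tensor2 \<Rightarrow> complex ^ 4 ^ 4" where
  "lower A = (\<chi> a b. A $ (a, b))"

lemma lower_eq_iff: "lower A = lower B \<longleftrightarrow> A = B"
  by (auto simp: lower_def vec_eq_iff)

lemma lower_scale: "lower (c *s A) = mat c ** lower A"
  by (simp add: vec_eq_iff mat_mult_component) (simp add: lower_def)

definition gup :: "real ^ 4 ^ 4 \<Rightarrow> complex ^ 4 ^ 4" where
  "gup g = (\<chi> a b. of_real (ginv g a b))"

text \<open>With its second index raised a 2-tensor is an endomorphism: \<open>dot2\<close> becomes
  the matrix product and metric contractions become traces.\<close>

definition mixed :: "real ^ 4 ^ 4 \<Rightarrow> tensor2 \<Rightarrow> complex ^ 4 ^ 4" where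
  "mixed g A = lower A ** gup g"

definition contract2 :: "real ^ 4 ^ 4 \<Rightarrow> tensor2 \<Rightarrow> tensor2 \<Rightarrow> complex" where
  "contract2 g A B = (\<Sum>a\<in>UNIV. \<Sum>b\<in>UNIV. A $ (a, b) * raise2 g B $ (a, b))"

definition bivector :: "tensor2 \<Rightarrow> bool" where
  "bivector F \<longleftrightarrow> transpose (lower F) = - lower F"

lemma bivector_iff: "bivector F \<longleftrightarrow> (\<forall>a b. F $ (a, b) = - F $ (b, a))"
  unfolding bivector_def lower_def transpose_def vec_eq_iff vec_lambda_beta vector_uminus_component
  by metis

lemma cnj2_component [simp]: "cnj2 A $ p = cnj (A $ p)"
  by (simp add: cnj2_def)

lemma cnj2_cnj2 [simp]: "cnj2 (cnj2 A) = A"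
  by (simp add: vec_eq_iff)

lemma raise2_cnj2: "raise2 g (cnj2 A) = cnj2 (raise2 g A)"
  by (simp add: vec_eq_iff raise2_def)

lemma dot2_cnj2: "dot2 g (cnj2 A) (cnj2 B) = cnj2 (dot2 g A B)"
  by (simp add: vec_eq_iff dot2_def)

lemma hodge2_cnj2: "hodge2 g s (cnj2 F) = cnj2 (hodge2 g s F)"
  by (simp add: vec_eq_iff hodge2_def raise2_cnj2)

lemma bimetric_cnj2: "bimetric g (cnj2 F) (cnj2 H) = cnj (bimetric g F H)"
  by (simp add: bimetric_def raise2_cnj2)

lemma lower_hodge2:
  "lower (hodge2 g s F) = mat (of_real (s * sqrt \<bar>det g\<bar>)) ** dual (lower (raise2 g F))"
  by (simp add: vec_eq_iff mat_mult_component)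
     (simp add: lower_def hodge2_def dual_def vol_def sum_distrib_left mult_ac)

lemma lower_raise2: "lower (raise2 g A) = gup g ** lower A ** transpose (gup g)"
  by (simp add: vec_eq_iff lower_def raise2_def gup_def matrix_matrix_mult_def transpose_def
      sum_distrib_left sum_distrib_right mult_ac) (intro allI sum.swap)

lemma lower_dot2: "lower (dot2 g A B) = lower A ** gup g ** lower B"
  by (simp add: vec_eq_iff lower_def dot2_def gup_def matrix_matrix_mult_def
      sum_distrib_left sum_distrib_right mult_ac) (intro allI sum.swap)

lemma mixed_dot2: "mixed g (dot2 g A B) = mixed g A ** mixed g B"
  by (simp add: mixed_def lower_dot2 matrix_mul_assoc)


lemma contract2_add: "contract2 g A (B + C) = contract2 g A B + contract2 g A C"
  by (simp add: contract2_def raise2_def sum.distrib algebra_simps)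

lemma contract2_scale: "contract2 g A (c *s B) = c * contract2 g A B"
  by (simp add: contract2_def raise2_def sum_distrib_left mult_ac)

lemma contract2_trace: "contract2 g A B = trace (lower A ** transpose (lower (raise2 g B)))"
  by (simp add: contract2_def trace_def matrix_matrix_mult_def transpose_def lower_def)

section \<open>Raising indices, and products of self-dual and anti-self-dual bivectors\<close>

locale metric =
  fixes g :: "real ^ 4 ^ 4"
  assumes symmetric: "transpose g = g" and invertible: "invertible g"
begin

lemma matrix_inv: "g ** matrix_inv g = mat 1" "matrix_inv g ** g = mat 1"
  using someI_ex[OF invertible[unfolded invertible_def]] by (auto simp: matrix_inv_def)

lemma transpose_gup: "transpose (gup g) = gup g"
proof -
  let ?h = "matrix_inv g"
  have "g ** ?h = mat 1"
    using matrix_inv(1) .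
  then have "transpose ?h ** g = mat 1"
    by (metis matrix_transpose_mul symmetric transpose_mat)
  then have "transpose ?h = ?h"
    by (metis \<open>g ** ?h = mat 1\<close> matrix_mul_assoc matrix_mul_lid matrix_mul_rid)
  then show ?thesis
    by (simp add: gup_def ginv_def vec_eq_iff transpose_def)
qed

lemma gup_inverse: "gup g ** (\<chi> a b. of_real (g $ a $ b)) = mat 1"
proof -
  have "(gup g ** (\<chi> a b. of_real (g $ a $ b))) $ i $ j = of_real ((matrix_inv g ** g) $ i $ j)" for i j
    by (simp add: gup_def ginv_def matrix_matrix_mult_def)
  then show ?thesis
    by (simp add: matrix_inv vec_eq_iff) (simp add: mat_def)
qed

text \<open>Raising an index is invertible, so identities between 2-tensors may be verified on the
  endomorphisms.\<close>

lemma mixed_eq_iff: "mixed g A = mixed g B \<longleftrightarrow> A = B"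
proof
  assume "mixed g A = mixed g B"
  then have "lower A ** (gup g ** (\<chi> a b. of_real (g $ a $ b))) =
      lower B ** (gup g ** (\<chi> a b. of_real (g $ a $ b)))"
    by (simp add: mixed_def matrix_mul_assoc)
  then show "A = B"
    by (simp add: gup_inverse lower_eq_iff)
qed simp

lemma lower_raise2_mixed: "lower (raise2 g A) = gup g ** mixed g A"
  by (simp add: lower_raise2 transpose_gup mixed_def matrix_mul_assoc)

lemma contract2_symmetric:
  assumes "transpose (lower B) = lower B"
  shows "contract2 g A B = trace (mixed g A ** mixed g B)"
  using assms
  by (simp add: contract2_trace lower_raise2 matrix_transpose_mul transpose_gup mixed_def matrix_mul_assoc)

lemma transpose_raise2_bivector:
  assumes "bivector F"
  shows "transpose (lower (raise2 g F)) = - lower (raise2 g F)"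
  using assms
  by (simp add: bivector_def lower_raise2 matrix_transpose_mul transpose_gup matrix_mul_assoc
      matrix_mult_minus)

text \<open>A trace of a product contracts the indices in reversed order; for an antisymmetric
  second argument this reversal costs a sign.\<close>

lemma bimetric_trace:
  assumes "bivector H"
  shows "bimetric g F H = - trace (mixed g F ** mixed g H) / 2"
proof -
  have "bimetric g F H = contract2 g F H / 2"
    by (simp add: bimetric_def contract2_def)
  also have "contract2 g F H = trace (lower F ** - lower (raise2 g H))"
    by (simp add: contract2_trace transpose_raise2_bivector[OF assms])
  also have "\<dots> = - trace (lower F ** lower (raise2 g H))"
    by (simp add: trace_def matrix_matrix_mult_def sum_negf)
  also have "lower F ** lower (raise2 g H) = mixed g F ** mixed g H"
    by (simp add: lower_raise2_mixed mixed_def matrix_mul_assoc)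
  finally show ?thesis .
qed

text \<open>The eigenvalue equations express \<open>c f h\<close> and \<open>d h f\<close> as
  \<sigma> times \<open>dual X ** Y\<close> and \<open>dual Y ** X\<close>, where X and Y are the
  contravariant components, so \<open>dual_anticommute\<close> makes the sum scalar. Taking the
  trace of the first expression turns \<sigma> times the trace of \<open>dual X ** Y\<close> into
  \<open>c * trace (f ** h)\<close>, which removes the volume factor.\<close>

lemma hodge_eigenvectors_product:
  assumes F: "bivector F" "hodge2 g s F = c *s F" and H: "bivector H" "hodge2 g s H = d *s H"
  defines "f \<equiv> mixed g F" and "h \<equiv> mixed g H"
  shows "mat c ** (f ** h) + mat d ** (h ** f) = mat (c * trace (f ** h) / 2)"
proof -
  define \<sigma> :: complex where "\<sigma> = of_real (s * sqrt \<bar>det g\<bar>)"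
  define X where "X = lower (raise2 g F)"
  define Y where "Y = lower (raise2 g H)"
  have X: "mat c ** lower F = mat \<sigma> ** dual X" and Y: "mat d ** lower H = mat \<sigma> ** dual Y"
    using arg_cong[OF F(2), of lower] arg_cong[OF H(2), of lower]
    by (simp_all add: lower_hodge2 lower_scale \<sigma>_def X_def Y_def)
  have XY: "X = gup g ** f" "Y = gup g ** h"
    by (simp_all add: X_def Y_def f_def h_def lower_raise2_mixed)
  have fh: "mat c ** (f ** h) = mat \<sigma> ** (dual X ** Y)"
    using arg_cong[OF X, of "\<lambda>M. M ** Y"]
    by (simp add: XY(2) f_def mixed_def matrix_mul_assoc)
  have hf: "mat d ** (h ** f) = mat \<sigma> ** (dual Y ** X)"
    using arg_cong[OF Y, of "\<lambda>M. M ** X"]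
    by (simp add: XY(1) h_def mixed_def matrix_mul_assoc)
  have "mat c ** (f ** h) + mat d ** (h ** f) = mat \<sigma> ** mat (trace (dual X ** Y) / 2)"
    unfolding fh hf
    using dual_anticommute[of X Y] transpose_raise2_bivector[OF F(1)] transpose_raise2_bivector[OF H(1)]
    by (simp add: X_def Y_def flip: matrix_add_ldistrib)
  also have "\<dots> = mat (c * trace (f ** h) / 2)"
    using arg_cong[OF fh, of trace] by (simp add: mat_mult_mat trace_mat_mult)
  finally show ?thesis .
qed

lemma sd_bivector: "F \<in> sd_bivectors g s \<Longrightarrow> bivector F"
  unfolding sd_bivectors_def bivector_iff by blast

lemma sd_hodge2: "F \<in> sd_bivectors g s \<Longrightarrow> hodge2 g s F = \<i> *s F"
  unfolding sd_bivectors_def by blast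

lemma bivector_cnj2: "bivector F \<Longrightarrow> bivector (cnj2 F)"
  unfolding bivector_iff cnj2_component by (metis complex_cnj_minus)

lemma sd_hodge2_cnj2: "F \<in> sd_bivectors g s \<Longrightarrow> hodge2 g s (cnj2 F) = - \<i> *s cnj2 F"
  by (simp add: hodge2_cnj2 sd_hodge2) (simp add: vec_eq_iff)

text \<open>A Clifford relation: both eigenvalues are the imaginary unit, which cancels, and the
  trace of the product is -2 times \<open>bimetric g F H\<close>.\<close>

lemma sd_anticommute:
  assumes "F \<in> sd_bivectors g s" "H \<in> sd_bivectors g s"
  shows "mixed g F ** mixed g H + mixed g H ** mixed g F = mat (- bimetric g F H)"
proof -
  have "mat \<i> ** (mixed g F ** mixed g H + mixed g H ** mixed g F) = mat \<i> ** mat (- bimetric g F H)"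
    using hodge_eigenvectors_product[OF sd_bivector[OF assms(1)] sd_hodge2[OF assms(1)]
        sd_bivector[OF assms(2)] sd_hodge2[OF assms(2)]]
    by (simp add: mat_mult_mat bimetric_trace sd_bivector[OF assms(2)] matrix_add_ldistrib)
  then show ?thesis
    by (rule mat_mult_cancel) simp
qed

text \<open>The eigenvalues are now opposite, so the commutator is a scalar matrix. A commutator has
  trace zero, hence this scalar vanishes, and with it the trace of the product.\<close>

lemma
  assumes "F \<in> sd_bivectors g s" "H \<in> sd_bivectors g s"
  shows sd_asd_commute: "mixed g F ** mixed g (cnj2 H) = mixed g (cnj2 H) ** mixed g F"
    and sd_asd_trace: "trace (mixed g F ** mixed g (cnj2 H)) = 0"
proof -
  let ?f = "mixed g F" and ?h = "mixed g (cnj2 H)"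
  have *: "mat \<i> ** (?f ** ?h) + mat (- \<i>) ** (?h ** ?f) = mat (\<i> * trace (?f ** ?h) / 2)"
    by (rule hodge_eigenvectors_product[OF sd_bivector[OF assms(1)] sd_hodge2[OF assms(1)]
        bivector_cnj2[OF sd_bivector[OF assms(2)]] sd_hodge2_cnj2[OF assms(2)]])
  have "trace (mat c :: complex ^ 4 ^ 4) = 4 * c" for c
    by (simp add: trace_def mat_def)
  with arg_cong[OF *, of trace] show tr: "trace (?f ** ?h) = 0"
    by (simp add: trace_add trace_mat_mult trace_mul_sym[of ?h ?f])
  have "mat \<i> ** (?f ** ?h) = mat \<i> ** (?h ** ?f)"
    using * unfolding vec_eq_iff tr
    by (simp add: mat_mult_component)
  then show "?f ** ?h = ?h ** ?f"
    by (rule mat_mult_cancel) simp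
qed

lemma sd_dot2_commute:
  assumes "F \<in> sd_bivectors g s" "H \<in> sd_bivectors g s"
  shows "dot2 g (cnj2 H) F = dot2 g F (cnj2 H)"
  using sd_asd_commute[OF assms] by (simp add: mixed_dot2 flip: mixed_eq_iff)

text \<open>Transposition reverses the two factors, the two antisymmetry signs cancel, and
  commutation restores the order.\<close>

lemma sd_dot2_symmetric:
  assumes "F \<in> sd_bivectors g s" "H \<in> sd_bivectors g s"
  shows "transpose (lower (dot2 g F (cnj2 H))) = lower (dot2 g F (cnj2 H))"
proof -
  have "transpose (lower (dot2 g F (cnj2 H))) = lower (dot2 g (cnj2 H) F)"
    using sd_bivector[OF assms(1)] bivector_cnj2[OF sd_bivector[OF assms(2)]]
    by (simp add: lower_dot2 matrix_transpose_mul transpose_gup bivector_def matrix_mul_assoc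
        matrix_mult_minus)
  then show ?thesis
    by (simp add: sd_dot2_commute[OF assms])
qed

lemma traceless_sym_iff:
  "A \<in> traceless_sym g \<longleftrightarrow> transpose (lower A) = lower A \<and> trace (mixed g A) = 0"
proof -
  have "trace (mixed g A) = (\<Sum>a\<in>UNIV. \<Sum>b\<in>UNIV. of_real (ginv g a b) * A $ (a, b))"
    using arg_cong[OF transpose_gup, of "\<lambda>M. M $ _ $ _"]
    by (simp add: trace_def mixed_def lower_def matrix_matrix_mult_def gup_def transpose_def mult.commute)
  moreover have "transpose (lower A) = lower A \<longleftrightarrow> (\<forall>a b. A $ (a, b) = A $ (b, a))"
    unfolding vec_eq_iff transpose_def lower_def vec_lambda_beta by metis
  ultimately show ?thesis
    by (simp add: traceless_sym_def)
qed

lemma sd_dot2_traceless_sym: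
  assumes "F \<in> sd_bivectors g s" "H \<in> sd_bivectors g s"
  shows "dot2 g F (cnj2 H) \<in> traceless_sym g"
  using assms by (simp add: traceless_sym_iff sd_dot2_symmetric mixed_dot2 sd_asd_trace)

text \<open>Commutation collects the self-dual factors in front of the anti-self-dual ones.
  Cyclicity of the trace then allows \<open>?f ** ?f'\<close> to be replaced by half the
  anticommutator, a scalar, and the trace of \<open>?h ** ?h'\<close> supplies the conjugate
  factor.\<close>

lemma contract2_sd_dot2:
  assumes F: "F \<in> sd_bivectors g s" "F' \<in> sd_bivectors g s"
    and H: "H \<in> sd_bivectors g s" "H' \<in> sd_bivectors g s"
  shows "contract2 g (dot2 g F (cnj2 H)) (dot2 g F' (cnj2 H')) = bimetric g F F' * cnj (bimetric g H H')"
proof -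
  let ?f = "mixed g F" and ?f' = "mixed g F'"
    and ?h = "mixed g (cnj2 H)" and ?h' = "mixed g (cnj2 H')"
  note comm = sd_asd_commute[OF F(2) H(1)] sd_asd_commute[OF F(1) H(1)] sd_asd_commute[OF F(1) H(2)]
  have fhfh: "contract2 g (dot2 g F (cnj2 H)) (dot2 g F' (cnj2 H')) = trace (?f ** ?f' ** (?h ** ?h'))"
    by (simp add: contract2_symmetric sd_dot2_symmetric[OF F(2) H(2)] mixed_dot2)
       (metis comm(1) matrix_mul_assoc)
  have "trace (?f' ** ?f ** (?h ** ?h')) = trace ((?f' ** (?h ** ?h')) ** ?f)"
    by (metis comm(2,3) matrix_mul_assoc)
  also have "\<dots> = trace (?f ** ?f' ** (?h ** ?h'))"
    by (metis trace_mul_sym matrix_mul_assoc)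
  finally have "2 * trace (?f ** ?f' ** (?h ** ?h')) = trace ((?f ** ?f' + ?f' ** ?f) ** (?h ** ?h'))"
    by (simp add: trace_add matrix_add_rdistrib)
  also have "\<dots> = - bimetric g F F' * trace (?h ** ?h')"
    by (simp add: sd_anticommute[OF F] trace_mat_mult)
  also have "trace (?h ** ?h') = - 2 * cnj (bimetric g H H')"
    by (simp add: bimetric_trace bivector_cnj2[OF sd_bivector[OF H(2)]] flip: bimetric_cnj2)
  finally show ?thesis
    by (simp add: fhfh)
qed

end

lemma lorentzian_metric:
  assumes "lorentzian g"
  shows "metric g"
proof
  show "transpose g = g"
    using assms by (simp add: lorentzian_def)
  obtain P where P: "transpose P ** g ** P = minkowski"
    using assms by (auto simp: lorentzian_def)
  \<comment> \<open>An involution has nonzero determinant; by multiplicativity the congruence with P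
    passes this to \<open>g\<close>.\<close>
  have "minkowski ** minkowski = mat 1"
    by (simp add: vec_eq_iff matrix_matrix_mult_def minkowski_def mat_def sum_4 forall_4)
  then have "det minkowski * det minkowski = 1"
    by (metis det_mul det_I)
  then have "det g \<noteq> 0"
    by (auto simp flip: P simp: det_mul)
  then show "invertible g"
    by (simp add: invertible_det_nz)
qed

section \<open>The linear map of a 4-tensor, and invariant spans\<close>

lemma tensor_map_add: "tensor_map g T (A + B) = tensor_map g T A + tensor_map g T B"
  by (simp add: vec_eq_iff tensor_map_def raise2_def sum.distrib algebra_simps)

lemma tensor_map_scale: "tensor_map g T (c *s A) = c *s tensor_map g T A"
  by (simp add: vec_eq_iff tensor_map_def raise2_def sum_distrib_left mult_ac)

text \<open>Each tensor product acts as a rank-one operator: contract with one factor and return the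
  other.\<close>

lemma tensor_map_sym_tensor:
  "tensor_map g (\<lambda>a b c d. sym_tensor A B a b c d + sym_tensor C D a b c d) X =
     contract2 g B X *s A + contract2 g A X *s B + (contract2 g D X *s C + contract2 g C X *s D)"
  by (simp add: vec_eq_iff tensor_map_def sym_tensor_def contract2_def sum_distrib_left
      sum.distrib algebra_simps)

lemma subspace_traceless_sym: "vec.subspace (traceless_sym g)"
  by (auto simp: vec.subspace_def traceless_sym_def distrib_left sum.distrib
      mult.left_commute[of _ "_ :: complex"] simp flip: sum_distrib_left)

text \<open>The preimage of the span under the map is a subspace, so it suffices to test
  generators.\<close>

lemma invariant_subspace_span:
  assumes "B \<subseteq> traceless_sym g" and "\<And>X. X \<in> B \<Longrightarrow> tensor_map g T X \<in> vec.span B"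
  shows "invariant_subspace g T (vec.span B)"
proof -
  have "vec.subspace {X. tensor_map g T X \<in> vec.span B}"
    unfolding vec.subspace_def
    by (auto simp: tensor_map_add tensor_map_scale vec.span_add vec.span_scale)
       (metis tensor_map_scale vec.span_zero vec.scale_zero_left)
  then have "vec.span B \<subseteq> {X. tensor_map g T X \<in> vec.span B}"
    using assms(2) by (intro vec.span_minimal) auto
  then show ?thesis
    using vec.span_minimal[OF assms(1) subspace_traceless_sym]
    by (auto simp: invariant_subspace_def)
qed

lemma in_span_2: "X \<in> vec.span {A, B} \<longleftrightarrow> (\<exists>a b. X = a *s A + b *s B)"
  by (auto simp: vec.span_breakdown_eq algebra_simps)

lemma in_span_3: "X \<in> vec.span {A, B, C} \<longleftrightarrow> (\<exists>a b c. X = a *s A + b *s B + c *s C)"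
  by (auto simp: vec.span_breakdown_eq algebra_simps)

section \<open>The Bel-Robinson tensor in terms of the null frame\<close>

context metric
begin

lemma bimetric_commute:
  assumes "F \<in> sd_bivectors g s" "H \<in> sd_bivectors g s"
  shows "bimetric g F H = bimetric g H F"
  using assms by (simp add: bimetric_trace sd_bivector trace_mul_sym[of "mixed g F"])

text \<open>Reversing the index pair of the antisymmetric second factor produces the sign; the signs
  cancel in the products below.\<close>

lemma contraction_eq_dot2:
  assumes "bivector B"
  shows "(\<Sum>r\<in>UNIV. \<Sum>t\<in>UNIV. of_real (ginv g r t) * (A $ (a, t) * cnj (B $ (m, r)))) =
    - dot2 g A (cnj2 B) $ (a, m)"
proof -
  have "B $ (m, r) = - B $ (r, m)" for r
    using assms unfolding bivector_iff by blast
  moreover have "ginv g r t = ginv g t r" for r t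
    using arg_cong[OF transpose_gup, of "\<lambda>M. M $ t $ r"] by (simp add: gup_def transpose_def)
  ultimately have "(\<Sum>r\<in>UNIV. \<Sum>t\<in>UNIV. of_real (ginv g r t) * (A $ (a, t) * cnj (B $ (m, r)))) =
    (\<Sum>r\<in>UNIV. \<Sum>t\<in>UNIV. - (A $ (a, t) * of_real (ginv g t r) * cnj (B $ (r, m))))"
    by (intro sum.cong) (simp_all add: mult_ac)
  then show ?thesis
    by (subst (asm) sum.swap) (simp add: dot2_def sum_negf)
qed

text \<open>Multiplying the symmetrized product by its conjugate gives four terms. In each, the sums
  over \<open>r, r'\<close> and over \<open>t, t'\<close> separate into two contractions
  \<open>p\<close>, each equal to minus a \<open>dot2\<close> product.\<close>

lemma bel_robinson_sym_tensor:
  assumes U: "bivector U" and L: "bivector L" and W: "sd_weyl g s W = sym_tensor U L"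
  shows "bel_robinson g s W a m b n =
    dot2 g U (cnj2 U) $ (a, m) * dot2 g L (cnj2 L) $ (b, n) +
    dot2 g U (cnj2 L) $ (a, m) * dot2 g L (cnj2 U) $ (b, n) +
    dot2 g L (cnj2 U) $ (a, m) * dot2 g U (cnj2 L) $ (b, n) +
    dot2 g L (cnj2 L) $ (a, m) * dot2 g U (cnj2 U) $ (b, n)"
proof -
  define p where "p A B a m r r' = of_real (ginv g r r') * (A $ (a, r') * cnj (B $ (m, r)))"
    for A B :: tensor2 and a m r r'
  have p: "(\<Sum>r\<in>UNIV. \<Sum>r'\<in>UNIV. p A B a m r r') = - dot2 g A (cnj2 B) $ (a, m)"
    if "bivector B" for A B a m
    unfolding p_def by (rule contraction_eq_dot2[OF that])
  have pp: "(\<Sum>r\<in>UNIV. \<Sum>t\<in>UNIV. \<Sum>r'\<in>UNIV. \<Sum>t'\<in>UNIV. p A B a m r r' * p C D b n t t') =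
      dot2 g A (cnj2 B) $ (a, m) * dot2 g C (cnj2 D) $ (b, n)"
    if "bivector B" "bivector D" for A B C D
    using p[OF that(1), of A a m] p[OF that(2), of C b n] by (simp flip: sum_product)
  have "bel_robinson g s W a m b n =
    (\<Sum>r\<in>UNIV. \<Sum>t\<in>UNIV. \<Sum>r'\<in>UNIV. \<Sum>t'\<in>UNIV.
      p U U a m r r' * p L L b n t t' + p U L a m r r' * p L U b n t t' +
      p L U a m r r' * p U L b n t t' + p L L a m r r' * p U U b n t t')"
    unfolding bel_robinson_def W sym_tensor_def p_def
    by (intro sum.cong refl) (simp add: algebra_simps)
  then show ?thesis
    by (simp add: sum.distrib pp U L)
qed

end

section \<open>Canonical expression, eigentensors and invariant subspaces\<close>

theorem proposition11:
  fixes g :: "real ^ 4 ^ 4" and s :: real and W :: "real tensor4"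
    and U L K \<Pi>\<^sub>0 \<Lambda> \<K> N \<Omega> M :: tensor2 and T :: "complex tensor4"
  assumes "lorentzian g" and "s = 1 \<or> s = - 1"
    and "weyl_tensor g W" and "petrov_type_III g s W"
    and "null_frame g s U L K" and "sd_weyl g s W = sym_tensor U L"
    and "\<Pi>\<^sub>0 = dot2 g U (cnj2 U)" and "\<Lambda> = dot2 g L (cnj2 L)" and "\<K> = dot2 g K (cnj2 K)"
    and "N = dot2 g U (cnj2 L)" and "\<Omega> = dot2 g U (cnj2 K)" and "M = dot2 g L (cnj2 K)"
    and "T = bel_robinson g s W"
  shows
    "(\<forall>a b c d. T a b c d = sym_tensor \<Lambda> \<Pi>\<^sub>0 a b c d + sym_tensor N (cnj2 N) a b c d) \<and>
     {c. \<exists>A. eigentensor g T c A} = {0} \<and>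
     (let E = vec.span {M, cnj2 M} in
        vec.dim E = 2 \<and> (\<forall>A\<in>E. A \<noteq> 0 \<longrightarrow> eigentensor g T 0 A)) \<and>
     (let I\<^sub>1 = vec.span {\<Pi>\<^sub>0, \<Lambda>, \<K>} in
        invariant_subspace g T I\<^sub>1 \<and> sole_eigentensor g T I\<^sub>1 \<Lambda>) \<and>
     (let I\<^sub>2 = vec.span {\<Omega>, cnj2 N} in
        invariant_subspace g T I\<^sub>2 \<and> sole_eigentensor g T I\<^sub>2 (cnj2 N)) \<and>
     (let I\<^sub>3 = vec.span {cnj2 \<Omega>, N} in
        invariant_subspace g T I\<^sub>3 \<and> sole_eigentensor g T I\<^sub>3 N)"
proof -
  interpret metric g
    using assms(1) by (rule lorentzian_metric)
  have sd: "U \<in> sd_bivectors g s" "L \<in> sd_bivectors g s" "K \<in> sd_bivectors g s"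
    and frame: "bimetric g U U = - 1" "bimetric g L K = - 1"
      "bimetric g U L = 0" "bimetric g U K = 0" "bimetric g L L = 0" "bimetric g K K = 0"
    using assms(5) by (simp_all only: null_frame_def)
  have frame': "bimetric g K L = - 1" "bimetric g L U = 0" "bimetric g K U = 0"
    using frame bimetric_commute sd by metis+
  have cnj_dot2: "cnj2 (dot2 g A (cnj2 B)) = dot2 g B (cnj2 A)"
    if "A \<in> sd_bivectors g s" "B \<in> sd_bivectors g s" for A B
    using sd_dot2_commute[OF that(2,1)] by (simp flip: dot2_cnj2)
  \<comment> \<open>Conjugation exchanges the two frame bivectors, so the conjugates also have the
    form to which the contraction formula applies.\<close>
  have conj: "cnj2 N = dot2 g L (cnj2 U)" "cnj2 \<Omega> = dot2 g K (cnj2 U)" "cnj2 M = dot2 g K (cnj2 L)"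
    using assms(10-12) sd by (simp_all add: cnj_dot2)
  have T_eq: "T a b c d = sym_tensor \<Lambda> \<Pi>\<^sub>0 a b c d + sym_tensor N (cnj2 N) a b c d" for a b c d
    using bel_robinson_sym_tensor[OF sd_bivector[OF sd(1)] sd_bivector[OF sd(2)] assms(6)]
    unfolding assms(13) sym_tensor_def conj unfolding assms(7,8,10) by simp
  then have T_fun: "T = (\<lambda>a b c d. sym_tensor \<Lambda> \<Pi>\<^sub>0 a b c d + sym_tensor N (cnj2 N) a b c d)"
    by (intro ext)
  have traceless: "\<Pi>\<^sub>0 \<in> traceless_sym g" "\<Lambda> \<in> traceless_sym g" "\<K> \<in> traceless_sym g"
    "N \<in> traceless_sym g" "cnj2 N \<in> traceless_sym g" "\<Omega> \<in> traceless_sym g"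
    "cnj2 \<Omega> \<in> traceless_sym g" "M \<in> traceless_sym g" "cnj2 M \<in> traceless_sym g"
    unfolding conj unfolding assms(7-12) using sd by (simp_all add: sd_dot2_traceless_sym)
  define D where "D A B = dot2 g A (cnj2 B)" for A B
  have contract: "contract2 g (D A B) (D A' B') = bimetric g A A' * cnj (bimetric g B B')"
    if "A \<in> {U, L, K}" "B \<in> {U, L, K}" "A' \<in> {U, L, K}" "B' \<in> {U, L, K}" for A B A' B'
    using that sd unfolding D_def by (intro contract2_sd_dot2[where s = s]) auto
  note D = assms(7-12)[folded D_def] and D_conj = conj[folded D_def]
  note ct = contract2_add contract2_scale contract frame frame'
  define t where "t = tensor_map g T"
  have t: "t X = contract2 g \<Pi>\<^sub>0 X *s \<Lambda> + contract2 g \<Lambda> X *s \<Pi>\<^sub>0 +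
      (contract2 g (cnj2 N) X *s N + contract2 g N X *s cnj2 N)" for X
    unfolding t_def T_fun by (rule tensor_map_sym_tensor)
  have t_linear: "t (X + Y) = t X + t Y" "t (c *s X) = c *s t X" for c X Y
    by (simp_all add: t_def tensor_map_add tensor_map_scale)
  \<comment> \<open>A contraction of \<open>D A B\<close> with \<open>D A' B'\<close> survives only
    if \<open>A'\<close> is the partner of \<open>A\<close> and \<open>B'\<close> that of
    \<open>B\<close>, where U is its own partner and L, K are partners; its value is then 1.\<close>
  have t_basis: "t \<Pi>\<^sub>0 = \<Lambda>" "t \<Lambda> = 0" "t \<K> = \<Pi>\<^sub>0" "t N = 0" "t (cnj2 N) = 0"
    "t \<Omega> = cnj2 N" "t (cnj2 \<Omega>) = N" "t M = 0" "t (cnj2 M) = 0"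
    unfolding t D_conj unfolding D by (simp_all add: ct)
  \<comment> \<open>Pairings with dual elements read off coefficients; they provide the nonvanishing
    and independence claims below.\<close>
  have dual_basis: "contract2 g \<K> \<Lambda> = 1" "contract2 g \<Pi>\<^sub>0 \<Pi>\<^sub>0 = 1" "contract2 g \<K> \<Pi>\<^sub>0 = 0"
    "contract2 g \<Pi>\<^sub>0 \<Lambda> = 0" "contract2 g \<Omega> N = 1" "contract2 g (cnj2 \<Omega>) (cnj2 N) = 1"
    "contract2 g (cnj2 M) M = 1" "contract2 g M (cnj2 M) = 1" "contract2 g (cnj2 M) (cnj2 M) = 0"
    unfolding D_conj unfolding D by (simp_all add: ct)
  have contract_0: "contract2 g A 0 = 0" for A
    using contract2_scale[of g A 0 0] by simp
  have nonzero: "\<Lambda> \<noteq> 0" "N \<noteq> 0" "cnj2 N \<noteq> 0" "M \<noteq> 0" "cnj2 M \<noteq> 0"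
    using dual_basis contract_0 by (metis zero_neq_one)+
  have eig: "eigentensor g T c A \<longleftrightarrow> A \<in> traceless_sym g \<and> A \<noteq> 0 \<and> t A = c *s A" for c A
    by (simp add: eigentensor_def t_def)
  \<comment> \<open>The image of \<open>t\<close> is spanned by \<Lambda>,
    \<open>\<Pi>\<^sub>0\<close>, N and \<open>cnj2 N\<close>; a second application leaves a
    multiple of \<Lambda>, which \<open>t\<close> annihilates. Hence an eigenvalue has cube
    zero.\<close>
  have nilpotent: "t (t (t X)) = 0" for X
    unfolding t[of X] by (simp add: t_linear t_basis)
  have eig_0: "c = 0" if "eigentensor g T c A" for c A
  proof -
    have "t (t (t A)) = (c * (c * c)) *s A"
      using that by (simp add: eig t_linear)
    then show ?thesis
      using that by (simp add: nilpotent eig)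
  qed
  have eigs: "{c. \<exists>A. eigentensor g T c A} = {0}"
    using eig_0 traceless(2) nonzero(1) t_basis(2) by (auto simp: eig intro!: exI[of _ \<Lambda>])

  have M_indep: "vec.independent {M, cnj2 M}" "M \<noteq> cnj2 M"
  proof -
    \<comment> \<open>Pairing with \<open>cnj2 M\<close> would give 1 = 0.\<close>
    have "M \<noteq> k *s cnj2 M" for k
      using dual_basis(7,9) contract2_scale[of g "cnj2 M" k "cnj2 M"] by auto
    then have "M \<notin> vec.span {cnj2 M}"
      by (auto simp: vec.span_singleton)
    then show "vec.independent {M, cnj2 M}"
      using nonzero(5) by (intro vec.independent_insertI) (simp_all add: vec.independent_empty)
    show "M \<noteq> cnj2 M"
      using dual_basis(7,9) by auto
  qed
  then have dim: "vec.dim (vec.span {M, cnj2 M}) = 2"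
    by (simp add: vec.dim_eq_card_independent)
  have E: "eigentensor g T 0 A" if A: "A \<in> vec.span {M, cnj2 M}" "A \<noteq> 0" for A
  proof -
    have "A \<in> traceless_sym g"
      using A(1) traceless vec.span_minimal[OF _ subspace_traceless_sym, of "{M, cnj2 M}" g] by blast
    moreover have "t A = 0"
      using A(1) by (auto simp: in_span_2 t_linear t_basis)
    ultimately show ?thesis
      using A(2) by (simp add: eig)
  qed

  have I1: "invariant_subspace g T (vec.span {\<Pi>\<^sub>0, \<Lambda>, \<K>})"
    using t_basis by (intro invariant_subspace_span) (auto simp: traceless vec.span_base vec.span_zero simp flip: t_def)
  have I2: "invariant_subspace g T (vec.span {\<Omega>, cnj2 N})"
    using t_basis by (intro invariant_subspace_span) (auto simp: traceless vec.span_base vec.span_zero simp flip: t_def)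
  have I3: "invariant_subspace g T (vec.span {cnj2 \<Omega>, N})"
    using t_basis by (intro invariant_subspace_span) (auto simp: traceless vec.span_base vec.span_zero simp flip: t_def)

  have S1: "sole_eigentensor g T (vec.span {\<Pi>\<^sub>0, \<Lambda>, \<K>}) \<Lambda>"
    unfolding sole_eigentensor_def
  proof (intro conjI allI impI)
    show "\<exists>c. eigentensor g T c \<Lambda>"
      by (intro exI[of _ 0]) (simp add: eig traceless nonzero t_basis)
    fix c A assume A: "A \<in> vec.span {\<Pi>\<^sub>0, \<Lambda>, \<K>} \<and> eigentensor g T c A"
    then obtain x y z where xyz: "A = x *s \<Pi>\<^sub>0 + y *s \<Lambda> + z *s \<K>"
      by (auto simp: in_span_3)
    \<comment> \<open>The eigenvalue is 0, so \<open>t A\<close> vanishes. Pairing with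
      \<open>\<K>\<close> isolates x, and pairing with \<open>\<Pi>\<^sub>0\<close> isolates
      z.\<close>
    have "x *s \<Lambda> + z *s \<Pi>\<^sub>0 = 0"
      using A eig_0[of c A] by (simp add: eig xyz t_linear t_basis)
    from arg_cong[OF this, of "contract2 g \<K>"] arg_cong[OF this, of "contract2 g \<Pi>\<^sub>0"]
    have "x = 0" "z = 0"
      by (simp_all add: contract2_add contract2_scale dual_basis contract_0)
    then show "\<exists>k. A = k *s \<Lambda>"
      by (intro exI[of _ y]) (simp add: xyz)
  qed (simp add: vec.span_base)
  \<comment> \<open>The second and third subspaces share this pattern, a Jordan chain of length two
    from X through Y to 0, whose kernel is the line of Y.\<close>
  have S2: "sole_eigentensor g T (vec.span {X, Y}) Y"
    if "t X = Y" "t Y = 0" "Y \<noteq> 0" "Y \<in> traceless_sym g" for X Y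
    unfolding sole_eigentensor_def
  proof (intro conjI allI impI)
    show "\<exists>c. eigentensor g T c Y"
      using that by (intro exI[of _ 0]) (simp add: eig)
    fix c A assume A: "A \<in> vec.span {X, Y} \<and> eigentensor g T c A"
    then obtain x y where xy: "A = x *s X + y *s Y"
      by (auto simp: in_span_2)
    have "x *s Y = 0"
      using A eig_0[of c A] that by (simp add: eig xy t_linear)
    then show "\<exists>k. A = k *s Y"
      using that by (intro exI[of _ y]) (simp add: xy)
  qed (simp add: vec.span_base)
  show ?thesis
    using T_eq eigs dim E I1 I2 I3 S1 S2[of \<Omega> "cnj2 N"] S2[of "cnj2 \<Omega>" N] t_basis nonzero traceless
    by (simp add: Let_def)
qed

end
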